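(* Let $A=(A_{ij})$ be an $m\times n$ matrix with entries in $\mathbb{R}\cup\{-\infty\}$, with $m\geq n$. Then the columns of $A$ are tropically linearly independent if and only if $A$ has a tropically non-singular $n\times n$ submatrix.
   Context: Write $[n]=\{1,\dots,n\}$. The columns of an $m\times n$ matrix $A$ with entries in $\mathbb{R}\cup\{-\infty\}$ are tropically linearly dependent if there exist scalars $x_1,\dots,x_n\in\mathbb{R}\cup\{-\infty\}$, not all equal to $-\infty$, such that for every row index $i\in[m]$ the maximum in $\max_{j\in[n]}(A_{ij}+x_j)$ is attained by at least two values of $j$ or is equal to $-\infty$. They are tropically linearly independent otherwise. An $n\times n$ matrix $B$ with entries in $\mathbb{R}\cup\{-\infty\}$ is tropically singular if the maximum $\max_{\sigma}\sum_{i\in[n]}B_{i\sigma(i)}$, taken over all permutations $\sigma$ of $[n]$, is either attained by at least two permutations or equal to $-\infty$; otherwise $B$ is tropically non-singular. An $n\times n$ submatrix of $A$ is obtained by selecting $n$ distinct rows (keeping all $n$ columns). *)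

theory Defs
  imports
    "HOL-Library.Extended_Real"
    "HOL-Combinatorics.Permutations"
    "Jordan_Normal_Form.DL_Submatrix"
begin

(* The tropical semiring is the set of extended reals other than \<infinity>; on this set
   the addition of ereal is the usual one, with -\<infinity> absorbing.
   Row and column indices start at 0, following the matrix library. *)

definition tropical_mat :: "ereal mat \<Rightarrow> bool" where
  "tropical_mat A \<longleftrightarrow> (\<forall>i<dim_row A. \<forall>j<dim_col A. A $$ (i, j) \<noteq> \<infinity>)"

definition tropical_vec :: "ereal vec \<Rightarrow> bool" where
  "tropical_vec x \<longleftrightarrow> (\<forall>j<dim_vec x. x $ j \<noteq> \<infinity>)"

(* Meaningful for finite nonempty S only (Max of the empty set is unspecified). *)
definition max_twice_or_minf :: "('a \<Rightarrow> ereal) \<Rightarrow> 'a set \<Rightarrow> bool" where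
  "max_twice_or_minf f S \<longleftrightarrow>
     (\<exists>a\<in>S. \<exists>b\<in>S. a \<noteq> b \<and> f a = Max (f ` S) \<and> f b = Max (f ` S)) \<or> Max (f ` S) = -\<infinity>"

(* With no columns there is no admissible x, so the empty family is independent. *)
definition tropically_dependent_cols :: "ereal mat \<Rightarrow> bool" where
  "tropically_dependent_cols A \<longleftrightarrow>
     (\<exists>x \<in> carrier_vec (dim_col A). tropical_vec x \<and> (\<exists>j<dim_col A. x $ j \<noteq> -\<infinity>) \<and>
        (\<forall>i<dim_row A. max_twice_or_minf (\<lambda>j. A $$ (i, j) + x $ j) {0..<dim_col A}))"

abbreviation tropically_independent_cols :: "ereal mat \<Rightarrow> bool" where
  "tropically_independent_cols A \<equiv> \<not> tropically_dependent_cols A"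

(* Used for square B only. *)
definition tropically_singular :: "ereal mat \<Rightarrow> bool" where
  "tropically_singular B \<longleftrightarrow>
     max_twice_or_minf (\<lambda>\<sigma>. \<Sum>i = 0..<dim_row B. B $$ (i, \<sigma> i)) {\<sigma>. \<sigma> permutes {0..<dim_row B}}"

abbreviation tropically_nonsingular :: "ereal mat \<Rightarrow> bool" where
  "tropically_nonsingular B \<equiv> \<not> tropically_singular B"

end

theory Submission
  imports Defs
begin

text \<open>
  Write \<open>a\<^sub>i\<^sub>j\<close> for the entries of the matrix. A vector \<open>x\<close> witnesses dependence of the columns iff
  in each row every finite term \<open>a\<^sub>i\<^sub>j + x\<^sub>j\<close> is matched by another term that is at least as large.
  Solving for \<open>x\<^sub>j\<close>, this says \<open>x \<le> F x\<close> coordinatewise, where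
  \<open>F x j = min\<^sub>i max\<^sub>k\<^sub>\<noteq>\<^sub>j (a\<^sub>i\<^sub>k - a\<^sub>i\<^sub>j + x\<^sub>k)\<close> and \<open>i\<close> ranges over the rows with finite
  \<open>a\<^sub>i\<^sub>j\<close>. The map \<open>F\<close> is monotone and commutes with adding a constant to all coordinates.

  The heart of the proof is an alternative (lemma \<open>dependent_or_column_dominant\<close>): either there is a
  nontrivial \<open>x\<close> with \<open>x \<le> F x\<close>, or there is a real vector \<open>y\<close> with \<open>F y < y\<close> in every coordinate.
  To see this, iterate from \<open>0\<close> the step that lowers each \<open>x\<^sub>j\<close> towards \<open>F x j\<close>, but by at most \<open>1\<close>.
  This cap keeps all the iterates real in spite of the entries \<open>-\<infinity>\<close>. The iterates
  decrease. If some coordinate stays bounded, their limit is a solution of \<open>x \<le> F x\<close>, nontrivial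
  because of that coordinate. Otherwise some iterate, say the \<open>N\<close>-th, is at most \<open>-1\<close> everywhere;
  adding \<open>k/N\<close> to the \<open>k\<close>-th iterate and taking the minimum over \<open>k < N\<close> gives a vector that the
  step strictly decreases.

  In the second case the inequality \<open>F y < y\<close> names, for each column \<open>j\<close>, a row \<open>\<rho> j\<close>
  in which column \<open>j\<close> is the only one to attain the maximum of \<open>a\<^sub>i\<^sub>k + y\<^sub>k\<close>. Hence \<open>\<rho>\<close> is injective,
  and in the square submatrix of these rows the permutation sending the row \<open>\<rho> j\<close> to \<open>j\<close> beats every
  other one, because adding \<open>y\<close> to all rows changes the weights of all permutations equally
  (lemma \<open>column_dominant_imp_nonsingular\<close>).

  Conversely, let \<open>x\<close> witness dependence and let a permutation have finite weight. The second
  large term in each row gives a fixed-point-free map on the columns with finite \<open>x\<^sub>j\<close>; it permutes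
  some nonempty set of columns, and rerouting the permutation along it does not decrease the weight
  (lemma \<open>dependent_imp_singular\<close>). So no square submatrix is nonsingular.
\<close>

section \<open>Maxima attained twice\<close>

text \<open>
  This form never mentions the value of the maximum. In particular, to refute a unique
  maximum it is enough to match every finite value by another one.
\<close>

lemma max_twice_or_minf_iff:
  assumes "finite S" "S \<noteq> {}"
  shows "max_twice_or_minf f S \<longleftrightarrow>
    (\<forall>a\<in>S. f a \<noteq> -\<infinity> \<longrightarrow> (\<exists>b\<in>S. b \<noteq> a \<and> f a \<le> f b))" (is "_ \<longleftrightarrow> ?R")
proof
  have le: "f a \<le> Max (f ` S)" if "a \<in> S" for a
    using assms that by simp
  show ?R if "max_twice_or_minf f S"
  proof (intro ballI impI)
    fix a assume a: "a \<in> S" "f a \<noteq> -\<infinity>"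
    from that le[OF a(1)] a(2) obtain b c where
      "b \<in> S" "c \<in> S" "b \<noteq> c" "f b = Max (f ` S)" "f c = Max (f ` S)"
      unfolding max_twice_or_minf_def by auto
    then show "\<exists>b\<in>S. b \<noteq> a \<and> f a \<le> f b"
      using le[OF a(1)] by (cases "a = b") auto
  qed
  show "max_twice_or_minf f S" if R: ?R
  proof -
    have "Max (f ` S) \<in> f ` S"
      using assms by (intro Max_in) auto
    then obtain a where a: "a \<in> S" "f a = Max (f ` S)"
      by auto
    show ?thesis
    proof (cases "f a = -\<infinity>")
      case True
      then show ?thesis using a unfolding max_twice_or_minf_def by simp
    next
      case False
      then obtain b where b: "b \<in> S" "b \<noteq> a" "f a \<le> f b"
        using R a(1) by blast
      then have "f b = Max (f ` S)"
        using le[OF b(1)] a(2) by simp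
      then show ?thesis
        using a b unfolding max_twice_or_minf_def by blast
    qed
  qed
qed

lemma max_twice_or_minf_cong:
  assumes "\<And>a. a \<in> S \<Longrightarrow> f a = g a"
  shows "max_twice_or_minf f S \<longleftrightarrow> max_twice_or_minf g S"
proof -
  have "f ` S = g ` S" using assms by (rule image_cong[OF refl])
  then show ?thesis unfolding max_twice_or_minf_def using assms by auto
qed

section \<open>Dependent columns force singularity\<close>

lemma sum_ereal_eq_MInfty:
  fixes f :: "'a \<Rightarrow> ereal"
  assumes "finite S" "\<And>r. r \<in> S \<Longrightarrow> f r \<noteq> \<infinity>" "\<exists>r\<in>S. f r = -\<infinity>"
  shows "sum f S = -\<infinity>"
proof -
  obtain r where r: "r \<in> S" "f r = -\<infinity>" using assms(3) by blast
  have "sum f (S - {r}) \<noteq> \<infinity>" using assms(1,2) by (auto simp: sum_Pinfty)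
  then show ?thesis using r assms(1) by (simp add: sum.remove)
qed

text \<open>
  This replaces the search for a cycle in the functional graph of \<open>f\<close>: a nonempty invariant set
  of least cardinality is mapped onto itself.
\<close>

lemma finite_self_map_bij_on_subset:
  assumes "finite J" "J \<noteq> {}" "f ` J \<subseteq> J"
  obtains K where "K \<subseteq> J" "K \<noteq> {}" "bij_betw f K K"
proof -
  define P where "P K \<longleftrightarrow> K \<subseteq> J \<and> K \<noteq> {} \<and> f ` K \<subseteq> K" for K
  have "P J" using assms by (simp add: P_def)
  then obtain K where K: "P K" and min: "\<And>L. P L \<Longrightarrow> card K \<le> card L"
    using exists_least_iff[of "\<lambda>c. \<exists>K. P K \<and> card K = c"] by (metis not_le_imp_less)
  have fin: "finite K" using K assms(1) finite_subset unfolding P_def by blast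
  have "P (f ` K)" using K unfolding P_def by auto
  then have "card K \<le> card (f ` K)" by (rule min)
  moreover have "f ` K \<subseteq> K" using K by (simp add: P_def)
  ultimately have "f ` K = K" using fin by (simp add: card_seteq)
  then have "bij_betw f K K"
    using fin by (simp add: bij_betw_def eq_card_imp_inj_on)
  then show thesis using that K unfolding P_def by blast
qed

text \<open>
  Given a permutation \<open>\<sigma>\<close> of finite weight, each row \<open>r\<close> with \<open>x (\<sigma> r)\<close> finite has a second
  column \<open>f (\<sigma> r)\<close> whose term is at least as large. Once \<open>f\<close> is restricted to a set that it permutes,
  summing these inequalities cancels the contributions of \<open>x\<close>, so that \<open>\<sigma>\<close> followed by \<open>f\<close> on
  that set weighs at least as much as \<open>\<sigma>\<close>.
\<close>

lemma dependent_imp_singular: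
  fixes b :: "'a \<Rightarrow> 'a \<Rightarrow> ereal" and x :: "'a \<Rightarrow> ereal"
  assumes fin: "finite S"
    and b: "\<And>r k. r \<in> S \<Longrightarrow> k \<in> S \<Longrightarrow> b r k \<noteq> \<infinity>"
    and x: "\<And>k. k \<in> S \<Longrightarrow> x k \<noteq> \<infinity>" and nontriv: "\<exists>k\<in>S. x k \<noteq> -\<infinity>"
    and dep: "\<And>r. r \<in> S \<Longrightarrow> max_twice_or_minf (\<lambda>k. b r k + x k) S"
  shows "max_twice_or_minf (\<lambda>\<sigma>. \<Sum>r\<in>S. b r (\<sigma> r)) {\<sigma>. \<sigma> permutes S}"
proof -
  have ne: "S \<noteq> {}" using nontriv by auto
  have "\<exists>\<tau>. \<tau> permutes S \<and> \<tau> \<noteq> \<sigma> \<and> (\<Sum>r\<in>S. b r (\<sigma> r)) \<le> (\<Sum>r\<in>S. b r (\<tau> r))"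
    if \<sigma>: "\<sigma> permutes S" and w: "(\<Sum>r\<in>S. b r (\<sigma> r)) \<noteq> -\<infinity>" for \<sigma>
  proof -
    have \<sigma>S: "\<sigma> r \<in> S" if "r \<in> S" for r using permutes_in_image[OF \<sigma>] that by simp
    have finb: "b r (\<sigma> r) \<noteq> -\<infinity>" if "r \<in> S" for r
    proof
      assume "b r (\<sigma> r) = -\<infinity>"
      then have "(\<Sum>r\<in>S. b r (\<sigma> r)) = -\<infinity>"
        using fin that b \<sigma>S by (intro sum_ereal_eq_MInfty) auto
      with w show False by simp
    qed
    define J where "J = {k\<in>S. x k \<noteq> -\<infinity>}"
    have "\<exists>k'. k' \<in> J \<and> k' \<noteq> k \<and> b (inv_into UNIV \<sigma> k) k + x k \<le> b (inv_into UNIV \<sigma> k) k' + x k'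
        \<and> b (inv_into UNIV \<sigma> k) k' \<noteq> -\<infinity>" if "k \<in> J" for k
    proof -
      define r where "r = inv_into UNIV \<sigma> k"
      have kS: "k \<in> S" and xk: "x k \<noteq> -\<infinity>" using that by (auto simp: J_def)
      have r: "r \<in> S" "\<sigma> r = k"
        using permutes_in_image[OF permutes_inv[OF \<sigma>]] kS permutes_inverses(1)[OF \<sigma>]
        by (auto simp: r_def)
      have "b r k + x k \<noteq> -\<infinity>" using finb[OF r(1)] r(2) xk by simp
      then obtain k' where k': "k' \<in> S" "k' \<noteq> k" "b r k + x k \<le> b r k' + x k'"
        using dep[OF r(1)] kS unfolding max_twice_or_minf_iff[OF fin ne] by blast
      then have fin': "b r k' + x k' \<noteq> -\<infinity>"
        using \<open>b r k + x k \<noteq> -\<infinity>\<close> by (metis ereal_infty_less_eq(2))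
      then have "b r k' \<noteq> -\<infinity>" "x k' \<noteq> -\<infinity>"
        using b[OF r(1) k'(1)] x[OF k'(1)] by (cases "b r k'"; cases "x k'"; auto)+
      then show ?thesis using k' unfolding r_def J_def by blast
    qed
    then obtain f where f: "\<And>k. k \<in> J \<Longrightarrow> f k \<in> J" "\<And>k. k \<in> J \<Longrightarrow> f k \<noteq> k"
      "\<And>k. k \<in> J \<Longrightarrow> b (inv_into UNIV \<sigma> k) k + x k \<le> b (inv_into UNIV \<sigma> k) (f k) + x (f k)"
      "\<And>k. k \<in> J \<Longrightarrow> b (inv_into UNIV \<sigma> k) (f k) \<noteq> -\<infinity>"
      by metis
    have "finite J" "J \<noteq> {}" "f ` J \<subseteq> J" using fin nontriv f(1) by (auto simp: J_def)
    then obtain K where K: "K \<subseteq> J" "K \<noteq> {}" "bij_betw f K K"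
      by (rule finite_self_map_bij_on_subset)
    \<comment> \<open>Since \<open>f\<close> has no fixed point in \<open>J\<close>, rerouting along it yields a different permutation.\<close>
    define \<pi> where "\<pi> k = (if k \<in> K then f k else k)" for k
    have "\<pi> permutes K"
      by (rule bij_imp_permutes) (use K(3) in \<open>auto simp: \<pi>_def cong: bij_betw_cong\<close>)
    then have \<pi>: "\<pi> permutes S" by (rule permutes_subset) (use K(1) in \<open>auto simp: J_def\<close>)
    have \<tau>: "(\<pi> \<circ> \<sigma>) permutes S" using \<sigma> \<pi> by (rule permutes_compose)
    obtain k where k: "k \<in> K" using K(2) by auto
    have "(\<pi> \<circ> \<sigma>) (inv_into UNIV \<sigma> k) \<noteq> \<sigma> (inv_into UNIV \<sigma> k)"
      using k K(1) f(2) permutes_inverses(1)[OF \<sigma>] by (auto simp: \<pi>_def)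
    then have neq: "\<pi> \<circ> \<sigma> \<noteq> \<sigma>" by metis
    \<comment> \<open>All the entries and coordinates that are moved are finite, so the comparison can be made in the reals.\<close>
    define u where "u k = real_of_ereal (x k)" for k
    define c where "c r k = real_of_ereal (b r k)" for r k
    have step: "b r (\<pi> (\<sigma> r)) = ereal (c r (\<pi> (\<sigma> r))) \<and>
        c r (\<sigma> r) + u (\<sigma> r) \<le> c r (\<pi> (\<sigma> r)) + u (\<pi> (\<sigma> r))" if r: "r \<in> S" for r
    proof (cases "\<sigma> r \<in> K")
      case True
      then have J: "\<sigma> r \<in> J" using K(1) by auto
      have inv_\<sigma>: "inv_into UNIV \<sigma> (\<sigma> r) = r" using permutes_inverses(2)[OF \<sigma>] by simp
      have fin': "\<bar>x (\<sigma> r)\<bar> \<noteq> \<infinity>" "\<bar>x (f (\<sigma> r))\<bar> \<noteq> \<infinity>"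
        "\<bar>b r (\<sigma> r)\<bar> \<noteq> \<infinity>" "\<bar>b r (f (\<sigma> r))\<bar> \<noteq> \<infinity>"
        using J f(1)[OF J] f(4)[OF J] finb[OF r] b[OF r] x by (auto simp: J_def inv_\<sigma>)
      from f(3)[OF J] show ?thesis unfolding inv_\<sigma> \<pi>_def c_def u_def using fin' True
        by (cases "x (\<sigma> r)"; cases "x (f (\<sigma> r))"; cases "b r (\<sigma> r)"; cases "b r (f (\<sigma> r))") auto
    next
      case False
      then show ?thesis using finb[OF r] b[OF r \<sigma>S[OF r]]
        by (cases "b r (\<sigma> r)") (auto simp: \<pi>_def c_def)
    qed
    have fin\<sigma>: "b r (\<sigma> r) = ereal (c r (\<sigma> r))" if "r \<in> S" for r
      using finb[OF that] b[OF that \<sigma>S[OF that]] by (cases "b r (\<sigma> r)") (auto simp: c_def)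
    have "(\<Sum>r\<in>S. c r (\<sigma> r)) + (\<Sum>r\<in>S. u (\<sigma> r))
        \<le> (\<Sum>r\<in>S. c r (\<pi> (\<sigma> r))) + (\<Sum>r\<in>S. u (\<pi> (\<sigma> r)))"
      unfolding sum.distrib[symmetric] using step by (intro sum_mono) blast
    moreover have "(\<Sum>r\<in>S. u (\<sigma> r)) = (\<Sum>r\<in>S. u (\<pi> (\<sigma> r)))"
      using sum.permute[OF \<sigma>, of u] sum.permute[OF \<tau>, of u] by (simp add: o_def)
    ultimately have "(\<Sum>r\<in>S. c r (\<sigma> r)) \<le> (\<Sum>r\<in>S. c r (\<pi> (\<sigma> r)))" by simp
    then have "(\<Sum>r\<in>S. b r (\<sigma> r)) \<le> (\<Sum>r\<in>S. b r ((\<pi> \<circ> \<sigma>) r))"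
      using fin\<sigma> step by simp
    then show ?thesis using \<tau> neq by blast
  qed
  moreover have "finite {\<sigma>. \<sigma> permutes S}" "{\<sigma>. \<sigma> permutes S} \<noteq> {}"
    using finite_permutations[OF fin] permutes_id by blast+
  ultimately show ?thesis by (subst max_twice_or_minf_iff) auto
qed

section \<open>Strict dominance forces nonsingularity\<close>

text \<open>
  Every permutation picks up the same total of the values of \<open>y\<close>, so comparing the weights of two
  permutations amounts to comparing the sums of the shifted entries, where \<open>\<sigma>\<close> wins in every row.
\<close>

lemma column_dominant_imp_nonsingular:
  fixes b :: "'a \<Rightarrow> 'a \<Rightarrow> ereal" and y :: "'a \<Rightarrow> real"
  assumes fin: "finite S"
    and b: "\<And>r k. r \<in> S \<Longrightarrow> k \<in> S \<Longrightarrow> b r k \<noteq> \<infinity>"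
    and \<sigma>: "\<sigma> permutes S"
    and dom: "\<And>r k. r \<in> S \<Longrightarrow> k \<in> S \<Longrightarrow> k \<noteq> \<sigma> r \<Longrightarrow> b r k + y k < b r (\<sigma> r) + y (\<sigma> r)"
    and fin\<sigma>: "\<And>r. r \<in> S \<Longrightarrow> b r (\<sigma> r) \<noteq> -\<infinity>"
  shows "\<not> max_twice_or_minf (\<lambda>\<sigma>. \<Sum>r\<in>S. b r (\<sigma> r)) {\<sigma>. \<sigma> permutes S}"
proof -
  have \<sigma>S: "\<sigma> r \<in> S" if "r \<in> S" for r using permutes_in_image[OF \<sigma>] that by simp
  define c where "c r k = real_of_ereal (b r k)" for r k
  have b\<sigma>: "b r (\<sigma> r) = ereal (c r (\<sigma> r))" if "r \<in> S" for r
    using fin\<sigma>[OF that] b[OF that \<sigma>S[OF that]] by (cases "b r (\<sigma> r)") (auto simp: c_def)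
  then have w\<sigma>: "(\<Sum>r\<in>S. b r (\<sigma> r)) = ereal (\<Sum>r\<in>S. c r (\<sigma> r))" by simp
  have less: "(\<Sum>r\<in>S. b r (\<tau> r)) < (\<Sum>r\<in>S. b r (\<sigma> r))" if \<tau>: "\<tau> permutes S" "\<tau> \<noteq> \<sigma>" for \<tau>
  proof (cases "\<exists>r\<in>S. b r (\<tau> r) = -\<infinity>")
    case True
    have \<tau>S: "\<tau> r \<in> S" if "r \<in> S" for r using permutes_in_image[OF \<tau>(1)] that by simp
    have "(\<Sum>r\<in>S. b r (\<tau> r)) = -\<infinity>" using True fin b \<tau>S by (intro sum_ereal_eq_MInfty) auto
    then show ?thesis by (simp add: w\<sigma>)
  next
    case False
    have \<tau>S: "\<tau> r \<in> S" if "r \<in> S" for r using permutes_in_image[OF \<tau>(1)] that by simp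
    have b\<tau>: "b r (\<tau> r) = ereal (c r (\<tau> r))" if "r \<in> S" for r
      using False that b[OF that \<tau>S[OF that]] by (cases "b r (\<tau> r)") (auto simp: c_def)
    obtain r where "\<tau> r \<noteq> \<sigma> r" using \<tau>(2) by auto
    then have r: "r \<in> S" "\<tau> r \<noteq> \<sigma> r" using \<sigma> \<tau>(1) unfolding permutes_def by metis+
    have lt: "c r (\<tau> r) + y (\<tau> r) < c r (\<sigma> r) + y (\<sigma> r)" if "r \<in> S" "\<tau> r \<noteq> \<sigma> r" for r
      using dom[OF that(1) \<tau>S[OF that(1)] that(2)] b\<sigma>[OF that(1)] b\<tau>[OF that(1)] by simp
    have "(\<Sum>r\<in>S. c r (\<tau> r) + y (\<tau> r)) < (\<Sum>r\<in>S. c r (\<sigma> r) + y (\<sigma> r))"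
    proof (rule sum_strict_mono_ex1[OF fin])
      show "\<forall>r\<in>S. c r (\<tau> r) + y (\<tau> r) \<le> c r (\<sigma> r) + y (\<sigma> r)"
        using lt by (metis order.order_iff_strict)
      show "\<exists>r\<in>S. c r (\<tau> r) + y (\<tau> r) < c r (\<sigma> r) + y (\<sigma> r)" using lt r by blast
    qed
    moreover have "(\<Sum>r\<in>S. y (\<tau> r)) = (\<Sum>r\<in>S. y (\<sigma> r))"
      using sum.permute[OF \<sigma>, of y] sum.permute[OF \<tau>(1), of y] by (simp add: o_def)
    ultimately have "(\<Sum>r\<in>S. c r (\<tau> r)) < (\<Sum>r\<in>S. c r (\<sigma> r))" by (simp add: sum.distrib)
    then show ?thesis using b\<tau> b\<sigma> by simp
  qed
  have P: "finite {\<sigma>. \<sigma> permutes S}" "{\<sigma>. \<sigma> permutes S} \<noteq> {}"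
    using finite_permutations[OF fin] permutes_id by blast+
  have "(\<Sum>r\<in>S. b r (\<sigma> r)) \<noteq> -\<infinity>" by (simp add: w\<sigma>)
  then show ?thesis
    using \<sigma> less unfolding max_twice_or_minf_iff[OF P] by (metis mem_Collect_eq not_le)
qed

section \<open>Iterating the capped lowering step\<close>

text \<open>
  With \<open>z\<^sub>k = G\<^sup>k 0 + k/N\<close>, monotonicity and the behaviour under shifts give
  \<open>G z\<^sub>k \<le> z\<^sub>k\<^sub>+\<^sub>1 - 1/N\<close>, and \<open>z\<^sub>N \<le> z\<^sub>0\<close> because \<open>G\<^sup>N 0 \<le> -1\<close>. So \<open>G\<close> maps the sequence cyclically
  below itself with a gain of \<open>1/N\<close>, and the minimum of \<open>z\<^sub>0, \<dots>, z\<^sub>N\<^sub>-\<^sub>1\<close> inherits this gain.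
\<close>

lemma exists_strictly_decreased_point:
  fixes G :: "('c \<Rightarrow> real) \<Rightarrow> 'c \<Rightarrow> real"
  assumes mono: "\<And>x y j. (\<And>k. k \<in> C \<Longrightarrow> x k \<le> y k) \<Longrightarrow> j \<in> C \<Longrightarrow> G x j \<le> G y j"
    and shift: "\<And>x t j. j \<in> C \<Longrightarrow> G (\<lambda>k. x k + t) j \<le> G x j + t"
    and N: "\<And>j. j \<in> C \<Longrightarrow> (G ^^ N) (\<lambda>_. 0) j \<le> -1"
  shows "\<exists>y. \<forall>j\<in>C. G y j < y j"
proof (cases "C = {}")
  case False
  with N have "N \<noteq> 0" by (cases N) auto
  define z where "z k = (\<lambda>j. (G ^^ k) (\<lambda>_. 0) j + real k / real N)" for k
  define y where "y j = Min ((\<lambda>k. z k j) ` {..<N})" for j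
  have y_le: "y j \<le> z k j" if "k < N" for k j
    unfolding y_def using that by (intro Min_le) auto
  have Gy: "G y j \<le> z (Suc k) j - 1 / real N" if "k < N" "j \<in> C" for k j
  proof -
    have "G y j \<le> G (z k) j" using y_le that by (intro mono)
    also have "\<dots> \<le> (G ^^ Suc k) (\<lambda>_. 0) j + real k / real N"
      unfolding z_def using shift[OF that(2)] by simp
    finally show ?thesis by (simp add: z_def add_divide_distrib)
  qed
  have "G y j < y j" if j: "j \<in> C" for j
  proof -
    have "Min ((\<lambda>k. z k j) ` {..<N}) \<in> (\<lambda>k. z k j) ` {..<N}"
      using \<open>N \<noteq> 0\<close> by (intro Min_in) auto
    then obtain k where k: "k < N" "y j = z k j" unfolding y_def by auto
    show ?thesis
    proof (cases k)
      case 0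
      have "z N j \<le> z 0 j" using N[OF j] \<open>N \<noteq> 0\<close> by (simp add: z_def)
      moreover have "G y j \<le> z N j - 1 / real N"
        using Gy[of "N - 1" j] j \<open>N \<noteq> 0\<close> by simp
      moreover have "1 / real N > 0" using \<open>N \<noteq> 0\<close> by simp
      moreover have "y j = z 0 j" using k(2) 0 by simp
      ultimately show ?thesis by linarith
    next
      case (Suc l)
      moreover have "1 / real N > 0" using \<open>N \<noteq> 0\<close> by simp
      moreover have "G y j \<le> y j - 1 / real N" using Gy[of l j] j k Suc by simp
      ultimately show ?thesis by linarith
    qed
  qed
  then show ?thesis by blast
qed auto

text \<open>
  The bound that row \<open>i\<close> puts on coordinate \<open>j\<close> of a dependency, given the other
  coordinates, relaxed to be no smaller than \<open>x j - 1\<close>. Entries \<open>-\<infinity>\<close> are left out, so it is the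
  maximum of a nonempty set of reals; it is meant for rows with finite \<open>a i j\<close>.
\<close>

definition row_bound :: "('r \<Rightarrow> 'c \<Rightarrow> ereal) \<Rightarrow> 'c set \<Rightarrow> ('c \<Rightarrow> real) \<Rightarrow> 'r \<Rightarrow> 'c \<Rightarrow> real" where
  "row_bound a C x i j = Max (insert (x j - 1)
     ((\<lambda>k. real_of_ereal (a i k) - real_of_ereal (a i j) + x k) ` {k\<in>C. k \<noteq> j \<and> a i k \<noteq> -\<infinity>}))"

definition lowering :: "('r \<Rightarrow> 'c \<Rightarrow> ereal) \<Rightarrow> 'r set \<Rightarrow> 'c set \<Rightarrow> ('c \<Rightarrow> real) \<Rightarrow> 'c \<Rightarrow> real" where
  "lowering a R C x j =
     Min (insert (x j) ((\<lambda>i. row_bound a C x i j) ` {i\<in>R. a i j \<noteq> -\<infinity>}))"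

lemma row_bound_le_iff:
  assumes "finite C"
  shows "row_bound a C x i j \<le> t \<longleftrightarrow> x j - 1 \<le> t \<and>
    (\<forall>k\<in>C. k \<noteq> j \<longrightarrow> a i k \<noteq> -\<infinity> \<longrightarrow> real_of_ereal (a i k) - real_of_ereal (a i j) + x k \<le> t)"
  unfolding row_bound_def using assms by (subst Max_le_iff) auto

lemma row_bound_less_iff:
  assumes "finite C"
  shows "row_bound a C x i j < t \<longleftrightarrow> x j - 1 < t \<and>
    (\<forall>k\<in>C. k \<noteq> j \<longrightarrow> a i k \<noteq> -\<infinity> \<longrightarrow> real_of_ereal (a i k) - real_of_ereal (a i j) + x k < t)"
  unfolding row_bound_def using assms by (subst Max_less_iff) auto

lemma le_lowering_iff:
  assumes "finite R"
  shows "t \<le> lowering a R C x j \<longleftrightarrow>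
    t \<le> x j \<and> (\<forall>i\<in>R. a i j \<noteq> -\<infinity> \<longrightarrow> t \<le> row_bound a C x i j)"
  unfolding lowering_def using assms by (subst Min_ge_iff) auto

lemma lowering_mono:
  assumes "finite R" "finite C" "\<And>k. k \<in> C \<Longrightarrow> x k \<le> y k" "j \<in> C"
  shows "lowering a R C x j \<le> lowering a R C y j"
proof -
  have y: "y j - 1 \<le> row_bound a C y i j"
    "\<And>k. k \<in> C \<Longrightarrow> k \<noteq> j \<Longrightarrow> a i k \<noteq> -\<infinity> \<Longrightarrow>
      real_of_ereal (a i k) - real_of_ereal (a i j) + y k \<le> row_bound a C y i j" for i
    using row_bound_le_iff[OF assms(2), of a y i j "row_bound a C y i j"] by simp_all
  have "row_bound a C x i j \<le> row_bound a C y i j" for i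
    unfolding row_bound_le_iff[OF assms(2)]
  proof (intro conjI ballI impI)
    show "x j - 1 \<le> row_bound a C y i j" using y(1)[of i] assms(3)[OF assms(4)] by linarith
    fix k assume "k \<in> C" "k \<noteq> j" "a i k \<noteq> -\<infinity>"
    then show "real_of_ereal (a i k) - real_of_ereal (a i j) + x k \<le> row_bound a C y i j"
      using y(2)[of k i] assms(3)[of k] by linarith
  qed
  moreover have "lowering a R C x j \<le> x j"
    "\<And>i. i \<in> R \<Longrightarrow> a i j \<noteq> -\<infinity> \<Longrightarrow> lowering a R C x j \<le> row_bound a C x i j"
    using le_lowering_iff[OF assms(1), of "lowering a R C x j" a C x j] by simp_all
  ultimately show ?thesis
    unfolding le_lowering_iff[OF assms(1)] using assms(3)[OF assms(4)] by (blast intro: order_trans)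
qed

lemma lowering_shift:
  assumes "finite R" "finite C"
  shows "lowering a R C (\<lambda>k. x k + t) j \<le> lowering a R C x j + t"
proof -
  have "row_bound a C (\<lambda>k. x k + t) i j \<le> row_bound a C x i j + t" for i
    using row_bound_le_iff[OF assms(2), of a x i j "row_bound a C x i j"]
    by (subst row_bound_le_iff[OF assms(2)]) (auto simp: algebra_simps)
  then have "lowering a R C (\<lambda>k. x k + t) j - t \<le> lowering a R C x j"
    using le_lowering_iff[OF assms(1), of "lowering a R C (\<lambda>k. x k + t) j" a C "\<lambda>k. x k + t" j]
    by (subst le_lowering_iff[OF assms(1)]) (force simp: diff_le_eq intro: order_trans)
  then show ?thesis by simp
qed

section \<open>The alternative\<close>

text \<open>
  If, in the limit, the term of column \<open>j\<close> were finite and strictly larger than the others, then the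
  bound of row \<open>i\<close> on coordinate \<open>j\<close> would eventually lie strictly below \<open>x j\<close>: the cap \<open>X t j - 1\<close>
  does, since \<open>X t j\<close> converges to \<open>x j\<close>. The next iterate would then fall below its limit.
\<close>

lemma lowering_iterates_limit_dependent:
  fixes a :: "'r \<Rightarrow> 'c \<Rightarrow> ereal"
  assumes fin: "finite R" "finite C" and i: "i \<in> R"
    and a: "\<And>k. k \<in> C \<Longrightarrow> a i k \<noteq> \<infinity>"
    and ne: "C \<noteq> {}"
  defines "X \<equiv> \<lambda>t. (lowering a R C ^^ t) (\<lambda>_. 0)"
  defines "x \<equiv> \<lambda>k. INF t. ereal (X t k)"
  shows "max_twice_or_minf (\<lambda>k. a i k + x k) C"
proof -
  have Suc: "X (Suc t) = lowering a R C (X t)" for t by (simp add: X_def)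
  have "X (Suc t) k \<le> X t k" for t k
    unfolding Suc using le_lowering_iff[OF fin(1), of "lowering a R C (X t) k" a C "X t" k] by simp
  then have dec: "decseq (\<lambda>t. ereal (X t k))" for k by (intro decseq_SucI) simp
  have lim: "(\<lambda>t. ereal (X t k)) \<longlonglongrightarrow> x k" for k
    unfolding x_def by (rule LIMSEQ_INF[OF dec])
  have x_le: "x k \<le> X t k" for t k unfolding x_def by (rule INF_lower) simp
  have "\<exists>k\<in>C. k \<noteq> j \<and> a i j + x j \<le> a i k + x k"
    if j: "j \<in> C" and "a i j + x j \<noteq> -\<infinity>" for j
  proof (rule ccontr)
    assume "\<not> ?thesis"
    then have gt: "a i k + x k < a i j + x j" if "k \<in> C" "k \<noteq> j" for k
      using that by (auto simp: not_le)
    have "x j \<noteq> \<infinity>" using x_le[of j 0] by auto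
    moreover have "a i j \<noteq> -\<infinity>" "x j \<noteq> -\<infinity>"
      using that a[OF j] x_le[of j 0] by auto
    ultimately obtain p q where p: "a i j = ereal p" and q: "x j = ereal q"
      using a[OF j] by (cases "a i j"; cases "x j") auto
    have q_le: "q \<le> X t j" for t using x_le[of j t] q by simp
    have "\<forall>\<^sub>F t in sequentially. real_of_ereal (a i k) - p + X t k < q"
      if k: "k \<in> C" "k \<noteq> j" "a i k \<noteq> -\<infinity>" for k
    proof -
      obtain s where s: "a i k = ereal s" using a[OF k(1)] k(3) by (cases "a i k") auto
      have "x k < ereal (q + p - s)" using gt[OF k(1,2)] s p q x_le[of k 0]
        by (cases "x k") auto
      then have "\<forall>\<^sub>F t in sequentially. ereal (X t k) < ereal (q + p - s)"
        using lim order_tendstoD(2) by blast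
      then show ?thesis by eventually_elim (simp add: s)
    qed
    then have "\<forall>\<^sub>F t in sequentially. \<forall>k\<in>{k\<in>C. k \<noteq> j \<and> a i k \<noteq> -\<infinity>}.
        real_of_ereal (a i k) - p + X t k < q"
      using fin(2) by (intro eventually_ball_finite) auto
    moreover have "\<forall>\<^sub>F t in sequentially. X t j - 1 < q"
    proof -
      have "x j < ereal (q + 1)" using q by simp
      then have "\<forall>\<^sub>F t in sequentially. ereal (X t j) < ereal (q + 1)"
        using lim order_tendstoD(2) by blast
      then show ?thesis by eventually_elim simp
    qed
    ultimately have "\<forall>\<^sub>F t in sequentially. row_bound a C (X t) i j < q"
      by eventually_elim (auto simp: row_bound_less_iff[OF fin(2)] p)
    then obtain t where "row_bound a C (X t) i j < q"
      using eventually_happens'[OF sequentially_bot] by blast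
    moreover have "X (Suc t) j \<le> row_bound a C (X t) i j"
      unfolding Suc using le_lowering_iff[OF fin(1), of "lowering a R C (X t) j" a C "X t" j]
        i p by simp
    ultimately show False using q_le[of "Suc t"] by simp
  qed
  then show ?thesis unfolding max_twice_or_minf_iff[OF fin(2) ne] by blast
qed

text \<open>
  A theorem of the alternative for tropical linear systems: \<open>x\<close> is a dependency of the columns, and
  \<open>y\<close> and \<open>\<rho>\<close> form a certificate that there is none.
\<close>

lemma dependent_or_column_dominant:
  fixes a :: "'r \<Rightarrow> 'c \<Rightarrow> ereal"
  assumes fin: "finite R" "finite C"
    and a: "\<And>i k. i \<in> R \<Longrightarrow> k \<in> C \<Longrightarrow> a i k \<noteq> \<infinity>"
  obtains
    (dependent) x :: "'c \<Rightarrow> ereal" where "\<And>k. x k \<noteq> \<infinity>" "\<exists>k\<in>C. x k \<noteq> -\<infinity>"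
      "\<And>i. i \<in> R \<Longrightarrow> max_twice_or_minf (\<lambda>k. a i k + x k) C"
  | (dominant) y :: "'c \<Rightarrow> real" and \<rho> where "\<And>j. j \<in> C \<Longrightarrow> \<rho> j \<in> R \<and> a (\<rho> j) j \<noteq> -\<infinity>"
      "\<And>j k. j \<in> C \<Longrightarrow> k \<in> C \<Longrightarrow> k \<noteq> j \<Longrightarrow> a (\<rho> j) k + y k < a (\<rho> j) j + y j"
proof -
  define X where "X = (\<lambda>t. (lowering a R C ^^ t) (\<lambda>_. 0))"
  have Suc: "X (Suc t) = lowering a R C (X t)" for t by (simp add: X_def)
  have "X (Suc t) k \<le> X t k" for t k
    unfolding Suc using le_lowering_iff[OF fin(1), of "lowering a R C (X t) k" a C "X t" k] by simp
  then have dec: "X t k \<le> X s k" if "s \<le> t" for s t k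
    using that by (rule lift_Suc_antimono_le)
  define x where "x = (\<lambda>k. INF t. ereal (X t k))"
  have x_le: "x k \<le> X t k" for t k unfolding x_def by (rule INF_lower) simp
  show thesis
  proof (cases "\<exists>k\<in>C. x k \<noteq> -\<infinity>")
    case True
    show thesis
    proof (rule dependent)
      show "x k \<noteq> \<infinity>" for k using x_le[of k 0] by auto
      show "max_twice_or_minf (\<lambda>k. a i k + x k) C" if "i \<in> R" for i
        unfolding x_def X_def
        by (rule lowering_iterates_limit_dependent) (use True fin a that in auto)
    qed fact
  next
    case False
    have "\<exists>t. X t k \<le> -1" if "k \<in> C" for k
    proof -
      have "(INF t. ereal (X t k)) < ereal (-1)" using False that by (simp add: x_def)
      then obtain t where "ereal (X t k) < ereal (-1)" unfolding INF_less_iff by blast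
      then show ?thesis by (intro exI[of _ t]) simp
    qed
    \<comment> \<open>As the iterates decrease, the sum of the \<open>T k\<close> is an iteration count that serves all columns.\<close>
    then obtain T where T: "\<And>k. k \<in> C \<Longrightarrow> X (T k) k \<le> -1" by metis
    have "X (\<Sum>k\<in>C. T k) j \<le> -1" if "j \<in> C" for j
      using dec[of "T j" "\<Sum>k\<in>C. T k" j] T[OF that] member_le_sum[of j C T] that fin by force
    then obtain y where y: "\<forall>j\<in>C. lowering a R C y j < y j"
      using exists_strictly_decreased_point[of C "lowering a R C"]
        lowering_mono[OF fin] lowering_shift[OF fin] unfolding X_def by metis
    have "\<exists>i. i \<in> R \<and> a i j \<noteq> -\<infinity> \<and> row_bound a C y i j < y j" if "j \<in> C" for j
      using y that le_lowering_iff[OF fin(1), of "y j" a C y j] by (force simp: not_le)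
    then obtain \<rho> where \<rho>: "\<And>j. j \<in> C \<Longrightarrow> \<rho> j \<in> R \<and> a (\<rho> j) j \<noteq> -\<infinity>"
      "\<And>j. j \<in> C \<Longrightarrow> row_bound a C y (\<rho> j) j < y j" by metis
    show thesis
    proof (rule dominant)
      fix j k assume jk: "j \<in> C" "k \<in> C" "k \<noteq> j"
      show "a (\<rho> j) k + y k < a (\<rho> j) j + y j"
        using \<rho>(1)[OF jk(1)] \<rho>(2)[OF jk(1)] jk a[of "\<rho> j" k] a[of "\<rho> j" j]
        unfolding row_bound_less_iff[OF fin(2)]
        by (cases "a (\<rho> j) k"; cases "a (\<rho> j) j") force+
    qed (use \<rho> in auto)
  qed
qed

section \<open>Submatrices and the equivalence\<close>

lemma tropically_singular_submatrix_iff: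
  assumes "A \<in> carrier_mat m n" "I \<subseteq> {0..<m}" "card I = n"
  shows "tropically_singular (submatrix A I UNIV) \<longleftrightarrow>
    max_twice_or_minf (\<lambda>\<sigma>. \<Sum>r\<in>{0..<n}. A $$ (pick I r, \<sigma> r)) {\<sigma>. \<sigma> permutes {0..<n}}"
proof -
  have I: "{i. i < m \<and> i \<in> I} = I" using assms(2) by auto
  have idx: "submatrix A I UNIV $$ (r, k) = A $$ (pick I r, k)" if "r < n" "k < n" for r k
    using submatrix_index[of r A I k UNIV] assms I that by (simp add: pick_UNIV)
  have dim: "dim_row (submatrix A I UNIV) = n"
    using assms I by (simp add: dim_submatrix)
  show ?thesis unfolding tropically_singular_def dim
  proof (rule max_twice_or_minf_cong)
    fix \<sigma> assume "\<sigma> \<in> {\<sigma>. \<sigma> permutes {0..<n}}"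
    then show "(\<Sum>r\<in>{0..<n}. submatrix A I UNIV $$ (r, \<sigma> r)) = (\<Sum>r\<in>{0..<n}. A $$ (pick I r, \<sigma> r))"
      using permutes_in_image[of \<sigma> "{0..<n}"] idx by (intro sum.cong) auto
  qed
qed

lemma bij_betw_pick:
  assumes "finite I"
  shows "bij_betw (pick I) {0..<card I} I"
proof -
  have "inj_on (pick I) {0..<card I}"
    by (intro linorder_inj_onI) (use pick_mono_le in \<open>force+\<close>)
  moreover have "pick I ` {0..<card I} \<subseteq> I" using pick_in_set_le by auto
  ultimately show ?thesis
    using assms by (simp add: bij_betw_def card_image card_subset_eq)
qed

theorem theorem1p4:
  fixes A :: "ereal mat" and m n :: nat
  assumes "A \<in> carrier_mat m n"
    and "tropical_mat A"
    and "m \<ge> n"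
  shows "tropically_independent_cols A \<longleftrightarrow>
    (\<exists>I \<subseteq> {0..<m}. card I = n \<and> tropically_nonsingular (submatrix A I UNIV))"
proof
  have dim: "dim_row A = m" "dim_col A = n" using assms(1) by auto
  have A: "A $$ (i, k) \<noteq> \<infinity>" if "i < m" "k < n" for i k
    using assms(2) that unfolding tropical_mat_def dim by blast
  {
    assume indep: "tropically_independent_cols A"
    show "\<exists>I \<subseteq> {0..<m}. card I = n \<and> tropically_nonsingular (submatrix A I UNIV)"
    proof (rule dependent_or_column_dominant[of "{0..<m}" "{0..<n}" "\<lambda>i k. A $$ (i, k)"])
      fix x :: "nat \<Rightarrow> ereal"
      assume x: "\<And>k. x k \<noteq> \<infinity>" "\<exists>k\<in>{0..<n}. x k \<noteq> -\<infinity>"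
        "\<And>i. i \<in> {0..<m} \<Longrightarrow> max_twice_or_minf (\<lambda>k. A $$ (i, k) + x k) {0..<n}"
      have "max_twice_or_minf (\<lambda>k. A $$ (i, k) + vec n x $ k) {0..<n}" if "i < m" for i
        using x(3)[of i] that by (subst max_twice_or_minf_cong[of _ _ "\<lambda>k. A $$ (i, k) + x k"]) auto
      then have "tropically_dependent_cols A"
        using x(1,2) unfolding tropically_dependent_cols_def dim
        by (intro bexI[of _ "vec n x"]) (auto simp: tropical_vec_def)
      with indep show ?thesis by contradiction
    next
      fix y :: "nat \<Rightarrow> real" and \<rho> :: "nat \<Rightarrow> nat"
      assume \<rho>: "\<And>j. j \<in> {0..<n} \<Longrightarrow> \<rho> j \<in> {0..<m} \<and> A $$ (\<rho> j, j) \<noteq> -\<infinity>"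
        and dom: "\<And>j k. j \<in> {0..<n} \<Longrightarrow> k \<in> {0..<n} \<Longrightarrow> k \<noteq> j \<Longrightarrow>
          A $$ (\<rho> j, k) + y k < A $$ (\<rho> j, j) + y j"
      \<comment> \<open>A row cannot have two different columns that each strictly dominate all others.\<close>
      have inj: "inj_on \<rho> {0..<n}"
      proof (rule inj_onI, rule ccontr)
        fix j k assume "j \<in> {0..<n}" "k \<in> {0..<n}" "\<rho> j = \<rho> k" "j \<noteq> k"
        then show False using dom[of j k] dom[of k j] by auto
      qed
      define I where "I = \<rho> ` {0..<n}"
      have I: "I \<subseteq> {0..<m}" "card I = n" "finite I"
        using \<rho> inj by (auto simp: I_def card_image)
      have pick: "bij_betw (pick I) {0..<n} I" using bij_betw_pick[OF I(3)] I(2) by simp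
      \<comment> \<open>Numbering the chosen rows increasingly turns the inverse of \<open>\<rho>\<close> into a permutation of the column indices.\<close>
      define s where "s = the_inv_into {0..<n} \<rho>"
      define \<sigma> where "\<sigma> r = (if r \<in> {0..<n} then s (pick I r) else r)" for r
      have "bij_betw s I {0..<n}"
        unfolding s_def I_def by (intro bij_betw_the_inv_into) (simp add: inj bij_betw_def)
      then have "bij_betw (s \<circ> pick I) {0..<n} {0..<n}" using pick by (rule bij_betw_trans[rotated])
      then have "bij_betw \<sigma> {0..<n} {0..<n}"
        by (rule bij_betw_cong[THEN iffD1, rotated]) (simp add: \<sigma>_def)
      then have \<sigma>: "\<sigma> permutes {0..<n}" by (rule bij_imp_permutes) (simp add: \<sigma>_def)
      have \<sigma>S: "\<sigma> r \<in> {0..<n}" if "r \<in> {0..<n}" for r using permutes_in_image[OF \<sigma>] that by blast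
      have row: "pick I r = \<rho> (\<sigma> r)" if "r \<in> {0..<n}" for r
        using bij_betwE[OF pick] that inj
        by (auto simp: \<sigma>_def s_def I_def f_the_inv_into_f)
      have "\<not> max_twice_or_minf (\<lambda>\<sigma>. \<Sum>r\<in>{0..<n}. A $$ (pick I r, \<sigma> r)) {\<sigma>. \<sigma> permutes {0..<n}}"
      proof (rule column_dominant_imp_nonsingular[OF _ _ \<sigma>])
        fix r assume r: "r \<in> {0..<n}"
        show "A $$ (pick I r, \<sigma> r) \<noteq> -\<infinity>" using \<rho>[OF \<sigma>S[OF r]] row[OF r] by simp
        fix k assume k: "k \<in> {0..<n}"
        show "A $$ (pick I r, k) \<noteq> \<infinity>" using A \<rho>[OF \<sigma>S[OF r]] row[OF r] k by simp
        show "A $$ (pick I r, k) + y k < A $$ (pick I r, \<sigma> r) + y (\<sigma> r)" if "k \<noteq> \<sigma> r"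
          using dom[OF \<sigma>S[OF r] k that] row[OF r] by simp
      qed simp
      then show ?thesis
        using I tropically_singular_submatrix_iff[OF assms(1) I(1,2)] by blast
    qed (use A in auto)
  }
  assume "\<exists>I \<subseteq> {0..<m}. card I = n \<and> tropically_nonsingular (submatrix A I UNIV)"
  then obtain I where I: "I \<subseteq> {0..<m}" "card I = n"
    and nonsing: "tropically_nonsingular (submatrix A I UNIV)" by blast
  have pick: "pick I r < m" if "r < n" for r
    using pick_in_set_le[of r I] I that by auto
  show "tropically_independent_cols A"
  proof
    assume "tropically_dependent_cols A"
    then obtain x where x: "tropical_vec x" "x \<in> carrier_vec n" "\<exists>j<n. x $ j \<noteq> -\<infinity>"
      and dep: "\<And>i. i < m \<Longrightarrow> max_twice_or_minf (\<lambda>j. A $$ (i, j) + x $ j) {0..<n}"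
      unfolding tropically_dependent_cols_def dim by blast
    have "max_twice_or_minf (\<lambda>\<sigma>. \<Sum>r\<in>{0..<n}. A $$ (pick I r, \<sigma> r)) {\<sigma>. \<sigma> permutes {0..<n}}"
    proof (rule dependent_imp_singular)
      show "x $ k \<noteq> \<infinity>" if "k \<in> {0..<n}" for k using x(1,2) that by (auto simp: tropical_vec_def)
    qed (use A pick x(3) dep in auto)
    then show False
      using nonsing tropically_singular_submatrix_iff[OF assms(1) I] by blast
  qed
qed

end
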